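(* Assume $\mathcal H$ is finite-dimensional and the gradients $\nabla f_i$ are globally Lipschitz continuous. Let $\alpha>0$ and $t_0>0$. Then for all $(u_0,v_0)\in\mathcal H\times\mathcal H$ there exists a function $(u(\cdot),v(\cdot)):[t_0,+\infty)\to\mathcal H\times\mathcal H$ which is absolutely continuous on $[t_0,T]$ for every $T>t_0$ and solves the differential inclusion $$(\dot u(t),\dot v(t))\in G(t,u(t),v(t))\ \text{ for almost all }t>t_0,\qquad (u(t_0),v(t_0))=(u_0,v_0),$$ where $G(t,u,v)=\{v\}\times\big(-\frac{\alpha}{t}v-\arg\min_{g\in C(u)}\langle g,-v\rangle\big)$.
   Context: $\mathcal H$ is a real Hilbert space. $f_1,\dots,f_m:\mathcal H\to\mathbb R$ are convex and continuously differentiable. $C(u)=\operatorname{co}\{\nabla f_i(u):i=1,\dots,m\}$. *)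

theory Defs
  imports "HOL-Analysis.Analysis"
begin

definition abs_continuous_on :: "real set \<Rightarrow> (real \<Rightarrow> 'a::real_normed_vector) \<Rightarrow> bool" where
  "abs_continuous_on S f \<longleftrightarrow>
     (\<forall>\<epsilon>>0. \<exists>\<delta>>0. \<forall>(n::nat) (a::nat \<Rightarrow> real) (b::nat \<Rightarrow> real).
        (\<forall>i<n. a i \<le> b i \<and> {a i..b i} \<subseteq> S) \<and>
        (\<forall>i<n. \<forall>j<n. i \<noteq> j \<longrightarrow> {a i<..<b i} \<inter> {a j<..<b j} = {}) \<and>
        (\<Sum>i<n. b i - a i) < \<delta>
        \<longrightarrow> (\<Sum>i<n. norm (f (b i) - f (a i))) < \<epsilon>)"

definition argmin_set :: "('a \<Rightarrow> real) \<Rightarrow> 'a set \<Rightarrow> 'a set" where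
  "argmin_set \<phi> A = {x \<in> A. \<forall>y\<in>A. \<phi> x \<le> \<phi> y}"

definition Cset :: "nat \<Rightarrow> (nat \<Rightarrow> 'a \<Rightarrow> 'a::real_inner) \<Rightarrow> 'a \<Rightarrow> 'a set" where
  "Cset m df u = convex hull {df i u | i. i \<in> {1..m}}"

definition Gmap :: "real \<Rightarrow> nat \<Rightarrow> (nat \<Rightarrow> 'a \<Rightarrow> 'a::real_inner) \<Rightarrow> real \<Rightarrow> 'a \<Rightarrow> 'a \<Rightarrow> ('a \<times> 'a) set" where
  "Gmap \<alpha> m df t u v =
     {v} \<times> {- (\<alpha> / t) *\<^sub>R v - g | g. g \<in> argmin_set (\<lambda>g. inner g (- v)) (Cset m df u)}"

end

theory Submission
  imports Defs "HOL-Complex_Analysis.Great_Picard"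
begin

text \<open>
  The map \<open>G\<close> has convex values, linear growth and a closed graph: membership in \<open>C(u)\<close> is tested by
  support functions, i.e. \<open>g \<in> C(u)\<close> iff every direction \<open>p\<close> admits an \<open>i\<close> with
  \<open>\<langle>g, p\<rangle> \<le> \<langle>\<nabla>f\<^sub>i(u), p\<rangle>\<close>, which is a closed condition on \<open>(u, g)\<close>. Euler step functions with mesh
  \<open>1 / (n + 1)\<close> are then locally bounded (Gronwall) and Lipschitz up to an error of the size of the
  mesh, so a subsequence converges pointwise to a locally Lipschitz \<open>x\<close>. Increments of the Euler scheme
  over \<open>[t, t + \<eta>]\<close> are averages of values of \<open>G\<close> near \<open>(t, x(t))\<close>; upper semicontinuity and convexity
  put \<open>x'(t)\<close> into \<open>G(t, x(t))\<close> wherever \<open>x\<close> is differentiable, and no weak compactness or measurable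
  selection is needed.

  A Lipschitz function of one variable is differentiable almost everywhere: after adding a linear
  function it is an increasing bi-Lipschitz map \<open>f\<close>. On the set \<open>E\<close> of points where difference quotients
  below \<open>p\<close> and above \<open>q > p\<close> both occur at arbitrarily small scales, the Vitali covering theorem gives
  \<open>|f(E)| \<le> p |E|\<close> and, applied to the inverse of \<open>f\<close>, \<open>|E| \<le> |f(E)| / q\<close>. Hence \<open>|E| = 0\<close>.
\<close>

section \<open>Differentiability of Lipschitz functions of one variable\<close>

lemma emeasure_image_le_if_small_slopes:
  fixes F :: "real \<Rightarrow> real"
  assumes F: "strict_mono F" and L: "L-lipschitz_on UNIV F"
    and A: "A \<in> sets lebesgue" and p: "p > 0"
    and slope: "\<And>x d. x \<in> A \<Longrightarrow> d > 0 \<Longrightarrow>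
      \<exists>a b. a < b \<and> x \<in> {a..b} \<and> b - a < d \<and> F b - F a \<le> p * (b - a)"
  shows "emeasure lebesgue (F ` A) \<le> ennreal p * emeasure lebesgue A"
proof (rule ennreal_le_epsilon)
  fix e :: real
  assume "e > 0"
  \<comment> \<open>The excess \<open>e / p\<close> becomes \<open>e\<close> after multiplication by
    \<open>p\<close>.\<close>
  obtain U where U: "open U" "A \<subseteq> U" "U - A \<in> lmeasurable" "emeasure lebesgue (U - A) < ennreal (e / p)"
    using sets_lebesgue_outer_open[OF A, of "e / p"] \<open>e > 0\<close> p by auto
  define K where "K = {(a, b). a < b \<and> {a..b} \<subseteq> U \<and> F b - F a \<le> p * (b - a)}"
  \<comment> \<open>Midpoint and half-length recast the intervals as the closed balls of the
    covering theorem; \<open>x\<close> only has to lie in the ball, not at its centre.\<close>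
  define c where "c = (\<lambda>(a, b). (a + b) / 2 :: real)"
  define r where "r = (\<lambda>(a, b). (b - a) / 2 :: real)"
  have ball: "cball (c i) (r i) = {fst i..snd i}" for i
    by (cases i) (auto simp: cball_eq_atLeastAtMost c_def r_def field_simps)
  obtain C where C: "countable C" "C \<subseteq> K"
    and disj: "pairwise (\<lambda>i j. disjnt (cball (c i) (r i)) (cball (c j) (r j))) C"
    and neg: "negligible (A - (\<Union>i\<in>C. cball (c i) (r i)))"
  proof (rule Vitali_covering_theorem_cballs[of K r A c])
    show "0 < r i" if "i \<in> K" for i
      using that by (auto simp: K_def r_def)
    show "\<exists>i. i \<in> K \<and> x \<in> cball (c i) (r i) \<and> r i < d" if x: "x \<in> A" and d: "0 < d" for x d
    proof -
      obtain \<rho> where \<rho>: "\<rho> > 0" "ball x \<rho> \<subseteq> U"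
        using U x openE by blast
      obtain a b where ab: "a < b" "x \<in> {a..b}" "b - a < min d \<rho>" "F b - F a \<le> p * (b - a)"
        using slope[OF x, of "min d \<rho>"] d \<rho> by auto
      have "{a..b} \<subseteq> ball x \<rho>"
        using ab by (auto simp: dist_real_def)
      then have "(a, b) \<in> K" using ab \<rho> by (auto simp: K_def)
      moreover have "x \<in> cball (c (a, b)) (r (a, b))" using ab by (simp add: ball)
      moreover have "r (a, b) < d" using ab by (simp add: r_def)
      ultimately show ?thesis by blast
    qed
  qed
  define N where "N = A - (\<Union>i\<in>C. {fst i..snd i})"
  have "negligible (F ` N)"
  proof (rule negligible_locally_Lipschitz_image)
    show "negligible N" using neg by (simp add: N_def ball)
    show "\<exists>T B. open T \<and> x \<in> T \<and> (\<forall>y\<in>N \<inter> T. norm (F y - F x) \<le> B * norm (y - x))" for x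
      using lipschitz_onD[OF L] by (intro exI[of _ UNIV] exI[of _ L]) (auto simp: dist_norm)
  qed simp
  then have null: "F ` N \<in> null_sets lebesgue" by (simp add: negligible_iff_null_sets)
  have meas: "(\<Union>i\<in>C. {F (fst i)..F (snd i)}) \<in> sets lebesgue"
    using C(1) by (intro sets.countable_UN') auto
  have "F ` A \<subseteq> (\<Union>i\<in>C. {F (fst i)..F (snd i)}) \<union> F ` N"
  proof
    fix y assume "y \<in> F ` A"
    then obtain x where x: "x \<in> A" "y = F x" by auto
    show "y \<in> (\<Union>i\<in>C. {F (fst i)..F (snd i)}) \<union> F ` N"
    proof (cases "x \<in> N")
      case False
      then obtain i where "i \<in> C" "fst i \<le> x" "x \<le> snd i" using x by (auto simp: N_def)
      then show ?thesis using x strict_mono_less_eq[OF F] by auto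
    qed (use x in auto)
  qed
  then have "emeasure lebesgue (F ` A) \<le> emeasure lebesgue ((\<Union>i\<in>C. {F (fst i)..F (snd i)}) \<union> F ` N)"
    using meas null by (intro emeasure_mono) auto
  also have "\<dots> = emeasure lebesgue (\<Union>i\<in>C. {F (fst i)..F (snd i)})"
    using meas null by (intro emeasure_Un_null_set) auto
  also have "\<dots> = (\<integral>\<^sup>+ i. emeasure lebesgue {F (fst i)..F (snd i)} \<partial>count_space C)"
  proof (rule emeasure_UN_countable)
    have "{F (fst i)..F (snd i)} \<inter> {F (fst j)..F (snd j)} = {}" if "i \<in> C" "j \<in> C" "i \<noteq> j" for i j
    proof -
      have "disjnt {fst i..snd i} {fst j..snd j}"
        using disj that by (auto simp: pairwise_def ball)
      moreover have "fst i < snd i" "fst j < snd j" using that C(2) by (auto simp: K_def)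
      ultimately have "snd i < fst j \<or> snd j < fst i"
        by (auto simp: disjnt_iff) (metis less_le_not_le linorder_not_le nle_le)
      then have "F (snd i) < F (fst j) \<or> F (snd j) < F (fst i)"
        using F by (auto simp: strict_mono_less)
      then show ?thesis by auto
    qed
    then show "disjoint_family_on (\<lambda>i. {F (fst i)..F (snd i)}) C"
      by (auto simp: disjoint_family_on_def)
  qed (use C in auto)
  also have "\<dots> \<le> (\<integral>\<^sup>+ i. ennreal p * emeasure lebesgue {fst i..snd i} \<partial>count_space C)"
  proof (rule nn_integral_mono)
    fix i assume "i \<in> space (count_space C)"
    then have "fst i < snd i" "F (snd i) - F (fst i) \<le> p * (snd i - fst i)"
      using C(2) by (auto simp: K_def)
    then show "emeasure lebesgue {F (fst i)..F (snd i)} \<le> ennreal p * emeasure lebesgue {fst i..snd i}"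
      using p strict_mono_less[OF F, of "fst i" "snd i"]
      by (simp add: emeasure_completion flip: ennreal_mult)
  qed
  also have "\<dots> = ennreal p * (\<integral>\<^sup>+ i. emeasure lebesgue {fst i..snd i} \<partial>count_space C)"
    by (simp add: nn_integral_cmult)
  also have "(\<integral>\<^sup>+ i. emeasure lebesgue {fst i..snd i} \<partial>count_space C) = emeasure lebesgue (\<Union>i\<in>C. {fst i..snd i})"
    using C disj by (intro emeasure_UN_countable[symmetric])
      (auto simp: disjoint_family_on_def pairwise_def ball disjnt_def)
  also have "\<dots> \<le> emeasure lebesgue U"
    using C U by (intro emeasure_mono) (force simp: K_def)+
  also have "emeasure lebesgue U = emeasure lebesgue A + emeasure lebesgue (U - A)"
    using plus_emeasure[of A lebesgue "U - A"] U A by (auto simp: Un_absorb1 Un_Diff_cancel)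
  also have "\<dots> \<le> emeasure lebesgue A + ennreal (e / p)"
    using U by (intro add_left_mono) auto
  finally show "emeasure lebesgue (F ` A) \<le> ennreal p * emeasure lebesgue A + ennreal e"
    using p \<open>e > 0\<close> by (simp add: distrib_left mult_left_mono flip: ennreal_mult)
qed

text \<open>If no rational pair separates frequent values, then \<open>s\<close> converges to its
  upper limit. Rational thresholds later turn the exceptional points into a countable union.\<close>

lemma exists_rationals_between_frequent_values:
  fixes s :: "'a \<Rightarrow> real"
  assumes bound: "eventually (\<lambda>x. \<bar>s x\<bar> \<le> B) F" and "F \<noteq> bot"
    and nolim: "\<nexists>l. (s \<longlongrightarrow> l) F"
  shows "\<exists>p\<in>\<rat>. \<exists>q\<in>\<rat>. p < q \<and> frequently (\<lambda>x. s x < p) F \<and> frequently (\<lambda>x. s x > q) F"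
proof (rule ccontr)
  assume contra: "\<not> ?thesis"
  have *: "eventually (\<lambda>x. s x \<ge> p) F"
    if "p \<in> \<rat>" "q \<in> \<rat>" "p < q" "frequently (\<lambda>x. s x > q) F" for p q
  proof -
    have "\<not> frequently (\<lambda>x. s x < p) F" using contra that by blast
    then show ?thesis by (simp add: not_frequently not_less)
  qed
  \<comment> \<open>The infimum of these eventual strict upper bounds is the upper limit of
    \<open>s\<close>.\<close>
  define S where "S = {p. eventually (\<lambda>x. s x < p) F}"
  have "B + 1 \<in> S"
    using bound by (auto simp: S_def elim!: eventually_mono)
  moreover have "-B \<le> p" if "p \<in> S" for p
  proof -
    have "eventually (\<lambda>x. -B \<le> p) F"
      using bound that unfolding S_def mem_Collect_eq by eventually_elim auto
    then show ?thesis using \<open>F \<noteq> bot\<close> by simp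
  qed
  then have bdd: "bdd_below S" by (rule bdd_belowI)
  have "(s \<longlongrightarrow> Inf S) F"
  proof (rule order_tendstoI)
    fix a assume "Inf S < a"
    then obtain p where "p \<in> S" "p < a"
      using bdd \<open>B + 1 \<in> S\<close> by (metis cInf_less_iff empty_iff)
    then show "eventually (\<lambda>x. s x < a) F"
      by (auto simp: S_def elim!: eventually_mono)
  next
    fix a assume "a < Inf S"
    then obtain p where p: "p \<in> \<rat>" "a < p" "p < Inf S" using Rats_dense_in_real by blast
    then obtain q where q: "q \<in> \<rat>" "p < q" "q < Inf S" using Rats_dense_in_real by blast
    \<comment> \<open>The gap between \<open>q\<close> and \<open>q'\<close> turns the frequent
      bound \<open>s x \<ge> q'\<close> into the strict bound \<open>s x > q\<close>.\<close>
    then obtain q' where q': "q < q'" "q' < Inf S" using dense by blast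
    then have "q' \<notin> S" using bdd cInf_lower by force
    then have "frequently (\<lambda>x. s x > q) F"
      using q'(1) unfolding S_def mem_Collect_eq not_eventually
      by (elim frequently_elim1) (simp add: not_less)
    from *[OF p(1) q(1,2) this] show "eventually (\<lambda>x. a < s x) F"
      using p by (auto elim!: eventually_mono)
  qed
  with nolim show False by blast
qed

text \<open>The bound \<open>upper\<close> makes \<open>f\<close> Lipschitz and \<open>lower\<close>
  makes its inverse 1-Lipschitz. The image estimate thus applies to \<open>f\<close> with factor
  \<open>p\<close> and to the inverse with factor \<open>1 / q\<close>; together they bound the
  measure of a bounded piece of the set by \<open>p / q < 1\<close> times itself.\<close>

lemma negligible_oscillating_slopes:
  fixes f :: "real \<Rightarrow> real"
  assumes lower: "\<And>x y. x \<le> y \<Longrightarrow> y - x \<le> f y - f x"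
    and upper: "\<And>x y. x \<le> y \<Longrightarrow> f y - f x \<le> B * (y - x)"
    and pq: "0 < p" "p < q"
  shows "negligible {x. (\<exists>\<^sub>F h in at 0. (f (x + h) - f x) / h < p) \<and>
                        (\<exists>\<^sub>F h in at 0. (f (x + h) - f x) / h > q)}"
    (is "negligible ?E")
proof -
  have "B \<ge> 1" using lower[of 0 1] upper[of 0 1] by simp
  have sm: "strict_mono f"
  proof (rule strict_monoI)
    show "f x < f y" if "x < y" for x y using lower[of x y] that by simp
  qed
  have lip: "B-lipschitz_on UNIV f"
  proof (rule lipschitz_onI)
    show "dist (f x) (f y) \<le> B * dist x y" for x y
      using lower[of x y] upper[of x y] lower[of y x] upper[of y x]
      by (cases "x \<le> y") (auto simp: dist_real_def abs_if)
  qed (use \<open>B \<ge> 1\<close> in simp)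
  then have cont: "continuous_on S f" for S
    by (meson lipschitz_on_continuous_on continuous_on_subset subset_UNIV)
  \<comment> \<open>Slopes of at least 1 carry \<open>f\<close> past \<open>y\<close> within
    distance \<open>\<bar>y - f 0\<bar>\<close> on either side of 0, so the intermediate value
    theorem applies.\<close>
  have "\<exists>x. f x = y" for y
  proof -
    have "f (- \<bar>y - f 0\<bar>) \<le> y" using lower[of "- \<bar>y - f 0\<bar>" 0] by simp
    moreover have "y \<le> f \<bar>y - f 0\<bar>" using lower[of 0 "\<bar>y - f 0\<bar>"] by simp
    ultimately show ?thesis using IVT'[of f "- \<bar>y - f 0\<bar>" y "\<bar>y - f 0\<bar>"] cont by auto
  qed
  then have "surj f" by (metis surjI)
  define g where "g = inv f"
  have fg: "f (g y) = y" for y unfolding g_def using \<open>surj f\<close> by (rule surj_f_inv_f)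
  have gf: "g (f x) = x" for x unfolding g_def using sm by (simp add: inv_f_f strict_mono_imp_inj_on)
  have smg: "strict_mono g" using sm by (metis fg strict_mono_less strict_monoI)
  have lipg: "1-lipschitz_on UNIV g"
  proof (rule lipschitz_onI)
    show "dist (g x) (g y) \<le> 1 * dist x y" for x y
      using lower[of "g x" "g y"] lower[of "g y" "g x"]
      by (cases "g x \<le> g y") (auto simp: dist_real_def fg)
  qed simp
  then have contg: "continuous_on UNIV g" by (rule lipschitz_on_continuous_on)

  \<comment> \<open>Countably many scales suffice. This writes \<open>?E\<close> as a countable
    intersection of unions, over \<open>h\<close>, of open sets; such unions are open however many
    \<open>h\<close> occur, so \<open>?E\<close> is Borel.\<close>
  have freq: "(\<exists>\<^sub>F h in at 0. P h) \<longleftrightarrow> (\<forall>n. \<exists>h. h \<noteq> 0 \<and> \<bar>h\<bar> < inverse (real (Suc n)) \<and> P h)"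
    for P :: "real \<Rightarrow> bool"
    unfolding frequently_at
    by (auto simp: dist_real_def) (metis less_trans reals_Archimedean of_nat_Suc)
  have "?E = (\<Inter>n. \<Union>h\<in>{h. h \<noteq> 0 \<and> \<bar>h\<bar> < inverse (real (Suc n))}. {x. (f (x + h) - f x) / h < p}) \<inter>
             (\<Inter>n. \<Union>h\<in>{h. h \<noteq> 0 \<and> \<bar>h\<bar> < inverse (real (Suc n))}. {x. (f (x + h) - f x) / h > q})"
    unfolding freq by blast
  also have "\<dots> \<in> sets borel"
  proof (intro sets.Int sets.countable_INT')
    have *: "continuous_on UNIV (\<lambda>x. (f (x + h) - f x) / h)" if "h \<noteq> 0" for h
      using that by (intro continuous_intros continuous_on_compose2[OF cont[of UNIV]]) auto
    show "(\<lambda>n. \<Union>h\<in>{h. h \<noteq> 0 \<and> \<bar>h\<bar> < inverse (real (Suc n))}. {x. (f (x + h) - f x) / h < p}) ` UNIV \<subseteq> sets borel"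
      "(\<lambda>n. \<Union>h\<in>{h. h \<noteq> 0 \<and> \<bar>h\<bar> < inverse (real (Suc n))}. {x. (f (x + h) - f x) / h > q}) ` UNIV \<subseteq> sets borel"
      using * by (intro image_subsetI borel_open open_UN ballI open_Collect_less continuous_on_const; simp)+
  qed auto
  finally have E: "?E \<in> sets borel" .

  \<comment> \<open>The increment \<open>h\<close> may have either sign, so the interval is spanned
    by \<open>x\<close> and \<open>x + h\<close> in the right order. The flag \<open>up\<close>
    treats both inequalities at once.\<close>
  have small: "\<exists>a b. a < b \<and> x \<in> {a..b} \<and> b - a < d \<and> (if up then f b - f a > r * (b - a) else f b - f a < r * (b - a))"
    if fr: "\<exists>\<^sub>F h in at 0. (if up then (f (x + h) - f x) / h > r else (f (x + h) - f x) / h < r)" and d: "d > 0"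
    for x d r up
  proof -
    obtain h where h: "h \<noteq> 0" "\<bar>h\<bar> < d"
      "if up then (f (x + h) - f x) / h > r else (f (x + h) - f x) / h < r"
      using fr[unfolded frequently_at, rule_format, OF d] by (auto simp: dist_real_def)
    show ?thesis
      using h by (intro exI[of _ "min x (x + h)"] exI[of _ "max x (x + h)"])
        (cases "h > 0"; cases up; auto simp: min_def max_def field_simps)
  qed

  \<comment> \<open>Intersecting with a box makes the measure finite, so that it can be cancelled at
    the end.\<close>
  have "negligible (?E \<inter> cbox a b)" for a b
  proof -
    let ?A = "?E \<inter> cbox a b"
    have A: "?A \<in> sets borel" using E by simp
    have fin: "emeasure lebesgue ?A < top"
    proof -
      have "emeasure lebesgue ?A \<le> emeasure lebesgue (cbox a b)" by (intro emeasure_mono) auto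
      also have "\<dots> < top" using fmeasurableD2[OF lmeasurable_cbox[of a b]] by (simp only: less_top)
      finally show ?thesis .
    qed
    have 1: "emeasure lebesgue (f ` ?A) \<le> ennreal p * emeasure lebesgue ?A"
    proof (rule emeasure_image_le_if_small_slopes[OF sm lip _ pq(1)])
      show "\<exists>a b. a < b \<and> x \<in> {a..b} \<and> b - a < d \<and> f b - f a \<le> p * (b - a)" if "x \<in> ?A" "0 < d" for x d
      proof -
        have "\<exists>a b. a < b \<and> x \<in> {a..b} \<and> b - a < d \<and> f b - f a < p * (b - a)"
          using small[where up = False and x = x and r = p and d = d] that by simp
        then show ?thesis by (meson less_imp_le)
      qed
    qed (use A in simp)
    \<comment> \<open>As preimages under the continuous inverse, images of Borel sets are
      Borel.\<close>
    have "f ` X = g -` X" for X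
    proof (intro set_eqI iffI)
      show "y \<in> f ` X" if "y \<in> g -` X" for y using that fg[of y] by (metis imageI vimage_eq)
    qed (auto simp: gf)
    then have "f ` ?A = g -` ?A" .
    also have "\<dots> \<in> sets borel"
      using measurable_sets[OF borel_measurable_continuous_onI[OF contg] A] by simp
    finally have fA: "f ` ?A \<in> sets borel" .
    have "emeasure lebesgue (g ` f ` ?A) \<le> ennreal (1 / q) * emeasure lebesgue (f ` ?A)"
    proof (rule emeasure_image_le_if_small_slopes[OF smg lipg])
      fix y d :: real
      assume y: "y \<in> f ` ?A" "0 < d"
      then obtain x where x: "x \<in> ?A" "y = f x" by auto
      \<comment> \<open>Length below \<open>d / B\<close> keeps the image interval
        \<open>{f a..f b}\<close> shorter than \<open>d\<close>.\<close>
      obtain a b where ab: "a < b" "x \<in> {a..b}" "b - a < d / B" "f b - f a > q * (b - a)"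
        using small[where up = True and x = x and r = q and d = "d / B"] x(1) y(2) \<open>B \<ge> 1\<close> by (auto simp del: atLeastAtMost_iff)
      have "f b - f a < d" using upper[of a b] ab \<open>B \<ge> 1\<close> by (simp add: field_simps)
      then show "\<exists>a b. a < b \<and> y \<in> {a..b} \<and> b - a < d \<and> g b - g a \<le> 1 / q * (b - a)"
        using ab x pq strict_mono_less[OF sm] strict_mono_less_eq[OF sm]
        by (intro exI[of _ "f a"] exI[of _ "f b"]) (auto simp: gf field_simps)
    qed (use pq fA in auto)
    also have "g ` f ` ?A = ?A" by (simp add: image_image gf)
    also have "ennreal (1 / q) * emeasure lebesgue (f ` ?A) \<le> ennreal (1 / q) * (ennreal p * emeasure lebesgue ?A)"
      using 1 by (intro mult_left_mono) auto
    finally have le: "emeasure lebesgue ?A \<le> ennreal (1 / q) * (ennreal p * emeasure lebesgue ?A)" .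
    obtain m where m: "emeasure lebesgue ?A = ennreal m" "m \<ge> 0"
      using fin by (cases "emeasure lebesgue ?A") auto
    have "m \<le> p / q * m" using le m pq by (simp flip: ennreal_mult)
    then have "m * (q - p) \<le> 0" using pq by (simp add: field_simps)
    then have "m = 0" using pq m by (simp add: mult_le_0_iff)
    then show ?thesis using m A by (simp add: negligible_iff_null_sets null_sets_def)
  qed
  then show ?thesis by (subst negligible_on_intervals) blast
qed


text \<open>Adding \<open>(L + 1) * x\<close> moves all difference quotients into the range from 1
  to \<open>2 * L + 1\<close> without changing where the function is differentiable. Where no
  derivative exists, the bounded quotients oscillate across some rational pair.\<close>

lemma negligible_not_differentiable_lipschitz_real:
  fixes f :: "real \<Rightarrow> real"
  assumes L: "L-lipschitz_on UNIV f"
  shows "negligible {x. \<not> f differentiable at x}"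
proof -
  define F where "F x = f x + (L + 1) * x" for x
  have d: "\<bar>f y - f x\<bar> \<le> L * \<bar>y - x\<bar>" for x y
    using lipschitz_onD[OF L, of y x] by (simp add: dist_real_def)
  have lower: "y - x \<le> F y - F x" and upper: "F y - F x \<le> (2 * L + 1) * (y - x)" if "x \<le> y" for x y
    using d[of y x] that by (auto simp: F_def algebra_simps abs_le_iff)
  define E where "E p q = {x. (\<exists>\<^sub>F h in at 0. (F (x + h) - F x) / h < p) \<and>
                             (\<exists>\<^sub>F h in at 0. (F (x + h) - F x) / h > q)}" for p q
  have slope: "1 \<le> (F (x + h) - F x) / h" "(F (x + h) - F x) / h \<le> 2 * L + 1" if "h \<noteq> 0" for x h
    using that lower[of x "x + h"] lower[of "x + h" x] upper[of x "x + h"] upper[of "x + h" x]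
    by (cases "h > 0"; simp add: field_simps)+
  have "\<exists>p\<in>{p\<in>\<rat>. p > 0}. \<exists>q\<in>{q\<in>\<rat>. q > p}. x \<in> E p q" if "\<not> f differentiable at x" for x
  proof -
    have "\<nexists>l. ((\<lambda>h. (F (x + h) - F x) / h) \<longlongrightarrow> l) (at 0)"
    proof
      assume "\<exists>l. ((\<lambda>h. (F (x + h) - F x) / h) \<longlongrightarrow> l) (at 0)"
      then obtain l where "(F has_field_derivative l) (at x)" unfolding DERIV_def by blast
      then have "((\<lambda>x. F x - (L + 1) * x) has_field_derivative (l - (L + 1))) (at x)"
        by (auto intro!: derivative_eq_intros)
      then have "(f has_field_derivative (l - (L + 1))) (at x)" by (simp add: F_def)
      with that show False using real_differentiable_def by blast
    qed
    moreover have "\<forall>\<^sub>F h in at 0. \<bar>(F (x + h) - F x) / h\<bar> \<le> 2 * L + 1"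
      using slope[of _ x] by (intro eventually_at_topological[THEN iffD2] exI[of _ UNIV]) (fastforce simp: abs_le_iff)
    ultimately obtain p q where pq: "p \<in> \<rat>" "q \<in> \<rat>" "p < q" "x \<in> E p q"
      using exists_rationals_between_frequent_values[of "\<lambda>h. (F (x + h) - F x) / h" "2 * L + 1" "at 0"]
      by (auto simp: E_def)
    \<comment> \<open>Some quotient lies below \<open>p\<close>, while every quotient is at least 1;
      this forces \<open>p > 0\<close>.\<close>
    obtain h where "h \<noteq> 0" "(F (x + h) - F x) / h < p"
      using pq(4) by (auto simp: E_def frequently_at dest!: spec[of _ 1])
    with slope(1)[of h x] have "p > 0" by linarith
    with pq show ?thesis by auto
  qed
  then have "{x. \<not> f differentiable at x} \<subseteq> (\<Union>p\<in>{p\<in>\<rat>. p > 0}. \<Union>q\<in>{q\<in>\<rat>. q > p}. E p q)"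
    by blast
  moreover have "negligible (\<Union>p\<in>{p\<in>\<rat>. p > 0}. \<Union>q\<in>{q\<in>\<rat>. q > p}. E p q)"
  proof (intro negligible_countable_Union countable_image)
    show "countable {p \<in> \<rat>. p > (c :: real)}" for c
      by (rule countable_subset[OF _ countable_rat]) auto
    then show "negligible S" if S: "S \<in> (\<lambda>p. \<Union>q\<in>{q\<in>\<rat>. q > p}. E p q) ` {p\<in>\<rat>. p > 0}" for S
      using S negligible_oscillating_slopes[of F, OF lower upper]
      by (auto simp: E_def intro!: negligible_countable_Union countable_image)
  qed
  ultimately show ?thesis using negligible_subset by blast
qed

lemma negligible_not_differentiable_lipschitz:
  fixes f :: "real \<Rightarrow> 'a::euclidean_space"
  assumes L: "L-lipschitz_on UNIV f"
  shows "negligible {x. \<not> f differentiable at x}"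
proof -
  have "negligible {x. \<not> (\<lambda>x. f x \<bullet> i) differentiable at x}" if "i \<in> Basis" for i
  proof (rule negligible_not_differentiable_lipschitz_real)
    show "L-lipschitz_on UNIV (\<lambda>x. f x \<bullet> i)"
    proof (rule lipschitz_onI)
      fix x y
      have "dist (f x \<bullet> i) (f y \<bullet> i) \<le> dist (f x) (f y)"
        using that by (metis dist_norm inner_diff_left norm_nth_le real_norm_def dist_real_def)
      then show "dist (f x \<bullet> i) (f y \<bullet> i) \<le> L * dist x y"
        using lipschitz_onD[OF L, of x y] by simp
    qed (rule lipschitz_on_nonneg[OF L])
  qed
  then have "negligible (\<Union>i\<in>Basis. {x. \<not> (\<lambda>x. f x \<bullet> i) differentiable at x})"
    by (intro negligible_Union) auto
  moreover have "{x. \<not> f differentiable at x} \<subseteq> (\<Union>i\<in>Basis. {x. \<not> (\<lambda>x. f x \<bullet> i) differentiable at x})"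
    by (auto simp: differentiable_componentwise_within[of f])
  ultimately show ?thesis using negligible_subset by blast
qed

lemma AE_differentiable_locally_lipschitz:
  fixes f :: "real \<Rightarrow> 'a::euclidean_space"
  assumes L: "\<And>T. \<exists>L. L-lipschitz_on {a..T} f"
  shows "AE t in lborel. t > a \<longrightarrow> f differentiable at t"
proof -
  \<comment> \<open>Clamping to \<open>{a..a + real n}\<close> is 1-Lipschitz, so
    \<open>f \<circ> c n\<close> is a Lipschitz function on the whole line that agrees with
    \<open>f\<close> inside the interval.\<close>
  define c where "c n t = max a (min (a + real n) t)" for n t
  have "AE t in lborel. (f \<circ> c n) differentiable at t" for n
  proof -
    obtain M where M: "M-lipschitz_on {a..a + real n} f" using L by blast
    have "1-lipschitz_on UNIV (c n)"
      by (rule lipschitz_onI) (auto simp: c_def dist_real_def max_def min_def)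
    moreover have "M-lipschitz_on (range (c n)) f"
      using M by (rule lipschitz_on_subset) (auto simp: c_def)
    ultimately have "(M * 1)-lipschitz_on UNIV (f \<circ> c n)"
      by (rule lipschitz_on_compose)
    from negligible_not_differentiable_lipschitz[OF this]
    have "AE t in lebesgue. (f \<circ> c n) differentiable at t"
      by (intro AE_I'[of "{t. \<not> (f \<circ> c n) differentiable at t}"]) (auto simp: negligible_iff_null_sets)
    then show ?thesis by (simp add: AE_completion_iff)
  qed
  then have "AE t in lborel. \<forall>n. (f \<circ> c n) differentiable at t"
    by (simp add: AE_all_countable)
  then show ?thesis
  proof (rule AE_mp, intro AE_I2 impI)
    fix t assume *: "\<forall>n. (f \<circ> c n) differentiable at t" and "a < t"
    obtain n where n: "t - a < real n" using reals_Archimedean2 by blast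
    obtain D where D: "((f \<circ> c n) has_derivative D) (at t)" using * by (auto simp: differentiable_def)
    have "(f has_derivative D) (at t)"
    proof (rule has_derivative_transform_within_open[OF D])
      show "open {a<..<a + real n}" "t \<in> {a<..<a + real n}" using n \<open>a < t\<close> by auto
      show "(f \<circ> c n) x = f x" if "x \<in> {a<..<a + real n}" for x
        using that by (auto simp: c_def)
    qed
    then show "f differentiable at t" by (auto simp: differentiable_def)
  qed
qed

section \<open>Differential inclusions with closed graph and linear growth\<close>

text \<open>The constant \<open>K\<close> is uniform in time, which rules out blow-up and gives
  solutions on the whole half-line.\<close>

locale differential_inclusion =
  fixes F :: "real \<Rightarrow> 'a::euclidean_space \<Rightarrow> 'a set" and t0 K :: real
  assumes closed_graph: "closed {(t, x, y). t0 \<le> t \<and> y \<in> F t x}"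
    and convex_values: "t0 \<le> t \<Longrightarrow> convex (F t x)"
    and nonempty_values: "t0 \<le> t \<Longrightarrow> F t x \<noteq> {}"
    and K_nonneg: "K \<ge> 0"
    and growth: "t0 \<le> t \<Longrightarrow> y \<in> F t x \<Longrightarrow> norm y \<le> K * (1 + norm x)"
begin

lemma closed_values:
  assumes "t0 \<le> t"
  shows "closed (F t x)"
proof -
  have "closed ((\<lambda>y. (t, x, y)) -` {(t, x, y). t0 \<le> t \<and> y \<in> F t x})"
    by (intro closed_vimage closed_graph continuous_intros)
  then show ?thesis using assms by (simp add: vimage_def)
qed

text \<open>Otherwise there are values \<open>y n\<close> at points tending to \<open>(t, x)\<close>
  that stay farther than \<open>e\<close> from \<open>F t x\<close>. Growth bounds them, so a
  subsequence converges, and the closed graph puts its limit into \<open>F t x\<close>.\<close>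

lemma upper_semicontinuous:
  assumes "t0 \<le> t" "e > 0"
  obtains \<delta> where "\<delta> > 0"
    "\<And>s z y. \<lbrakk>t0 \<le> s; \<bar>s - t\<bar> < \<delta>; norm (z - x) < \<delta>; y \<in> F s z\<rbrakk> \<Longrightarrow> \<exists>y'\<in>F t x. norm (y - y') \<le> e"
proof (rule ccontr)
  assume "\<not> thesis"
  with that have "\<forall>\<delta>>0. \<exists>s z y. t0 \<le> s \<and> \<bar>s - t\<bar> < \<delta> \<and> norm (z - x) < \<delta> \<and> y \<in> F s z \<and>
      (\<forall>y'\<in>F t x. norm (y - y') > e)"
    by (metis not_le)
  then have "\<forall>n. \<exists>s z y. t0 \<le> s \<and> \<bar>s - t\<bar> < inverse (real (Suc n)) \<and> norm (z - x) < inverse (real (Suc n)) \<and>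
      y \<in> F s z \<and> (\<forall>y'\<in>F t x. norm (y - y') > e)"
    by simp
  then obtain s z y where s: "\<And>n. t0 \<le> s n" "\<And>n. \<bar>s n - t\<bar> < inverse (real (Suc n))"
    and z: "\<And>n. norm (z n - x) < inverse (real (Suc n))"
    and y: "\<And>n. y n \<in> F (s n) (z n)" "\<And>n y'. y' \<in> F t x \<Longrightarrow> norm (y n - y') > e"
    by metis
  have "norm (y n) \<le> K * (2 + norm x)" for n
  proof -
    have "norm (z n - x) \<le> 1" using z[of n] inverse_le_1_iff[of "real (Suc n)"] by linarith
    then have "norm (z n) \<le> 1 + norm x" using norm_triangle_sub[of "z n" x] by linarith
    then show ?thesis using growth[OF s(1) y(1), of n] K_nonneg
      by (smt (verit) mult_left_mono)
  qed
  then have "bounded (range y)" by (auto simp: bounded_iff)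
  then obtain l r where r: "strict_mono r" "(y \<circ> r) \<longlonglongrightarrow> l"
    using bounded_imp_convergent_subsequence by blast
  have "(\<lambda>n. s n - t) \<longlonglongrightarrow> 0" "(\<lambda>n. z n - x) \<longlonglongrightarrow> 0"
    by (rule Lim_null_comparison[OF _ LIMSEQ_inverse_real_of_nat];
        use s(2) z in \<open>auto intro!: always_eventually less_imp_le\<close>)+
  then have "s \<longlonglongrightarrow> t" "z \<longlonglongrightarrow> x" by (simp_all add: LIM_zero_iff)
  then have "(s \<circ> r) \<longlonglongrightarrow> t" "(z \<circ> r) \<longlonglongrightarrow> x" using r(1) LIMSEQ_subseq_LIMSEQ by blast+
  then have "(\<lambda>n. ((s \<circ> r) n, (z \<circ> r) n, (y \<circ> r) n)) \<longlonglongrightarrow> (t, x, l)"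
    using r(2) by (intro tendsto_intros)
  then have "(t, x, l) \<in> {(t, x, y). t0 \<le> t \<and> y \<in> F t x}"
    by (rule closed_sequentially[OF closed_graph, rotated]) (use s(1) y(1) in auto)
  then have "l \<in> F t x" by simp
  moreover have "\<forall>\<^sub>F n in sequentially. norm ((y \<circ> r) n - l) < e"
    using tendstoD[OF r(2) \<open>e > 0\<close>] by (simp add: dist_norm)
  ultimately show False
    using y(2) by (metis (no_types, lifting) comp_apply eventually_sequentially le_refl not_less_iff_gr_or_eq)
qed

section \<open>Euler scheme and a priori bounds\<close>

definition selection :: "real \<Rightarrow> 'a \<Rightarrow> 'a" where
  "selection t x = (SOME y. y \<in> F t x)"

lemma selection: "t0 \<le> t \<Longrightarrow> selection t x \<in> F t x"
  unfolding selection_def using nonempty_values by (simp add: some_in_eq)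

definition mesh :: "nat \<Rightarrow> real" where
  "mesh n = inverse (real (Suc n))"

lemma mesh_pos: "mesh n > 0"
  by (simp add: mesh_def)

lemma mesh_tendsto: "mesh \<longlonglongrightarrow> 0"
  unfolding mesh_def by (rule LIMSEQ_inverse_real_of_nat)

primrec euler :: "'a \<Rightarrow> nat \<Rightarrow> nat \<Rightarrow> 'a" where
  "euler x0 n 0 = x0"
| "euler x0 n (Suc k) = euler x0 n k + mesh n *\<^sub>R selection (t0 + real k * mesh n) (euler x0 n k)"

definition slope :: "'a \<Rightarrow> nat \<Rightarrow> nat \<Rightarrow> 'a" where
  "slope x0 n k = selection (t0 + real k * mesh n) (euler x0 n k)"

lemma slope_in: "slope x0 n k \<in> F (t0 + real k * mesh n) (euler x0 n k)"
  unfolding slope_def by (intro selection) (use mesh_pos[of n] in simp)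

text \<open>The Gronwall bound for \<open>1 + norm\<close> of the Euler points up to time
  \<open>T\<close>; including the 1 turns the affine growth condition into a purely multiplicative
  recursion.\<close>

definition radius :: "'a \<Rightarrow> real \<Rightarrow> real" where
  "radius x0 T = exp (K * (T - t0)) * (1 + norm x0)"

definition speed :: "'a \<Rightarrow> real \<Rightarrow> real" where
  "speed x0 T = K * radius x0 T"

lemma radius_pos: "radius x0 T > 0"
  by (simp add: radius_def add_pos_nonneg)

lemma speed_nonneg: "speed x0 T \<ge> 0"
  using K_nonneg radius_pos[of x0 T] by (simp add: speed_def)

text \<open>Each step multiplies \<open>1 + norm\<close> by at most \<open>1 + K * mesh n\<close>,
  which is at most \<open>exp (K * mesh n)\<close>.\<close>

lemma euler_bound:
  assumes "t0 + real k * mesh n \<le> T"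
  shows "1 + norm (euler x0 n k) \<le> radius x0 T"
proof -
  have "1 + norm (euler x0 n k) \<le> (1 + K * mesh n) ^ k * (1 + norm x0)"
  proof (induction k)
    case (Suc k)
    have "norm (slope x0 n k) \<le> K * (1 + norm (euler x0 n k))"
      using growth[OF _ slope_in] mesh_pos[of n] by simp
    then have "norm (mesh n *\<^sub>R slope x0 n k) \<le> mesh n * (K * (1 + norm (euler x0 n k)))"
      using mesh_pos[of n] by simp
    then have "1 + norm (euler x0 n (Suc k)) \<le> (1 + K * mesh n) * (1 + norm (euler x0 n k))"
      using norm_triangle_ineq[of "euler x0 n k" "mesh n *\<^sub>R slope x0 n k"]
      by (simp add: slope_def algebra_simps)
    also have "\<dots> \<le> (1 + K * mesh n) * ((1 + K * mesh n) ^ k * (1 + norm x0))"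
      using Suc K_nonneg mesh_pos[of n] by (intro mult_left_mono) auto
    finally show ?case by (simp add: mult.assoc)
  qed simp
  also have "(1 + K * mesh n) ^ k \<le> exp (K * mesh n) ^ k"
    using K_nonneg mesh_pos[of n] exp_ge_add_one_self[of "K * mesh n"] by (intro power_mono) auto
  also have "\<dots> = exp (K * (real k * mesh n))"
    by (simp add: exp_of_nat_mult[symmetric] mult_ac)
  also have "\<dots> \<le> exp (K * (T - t0))"
    using assms K_nonneg by (simp add: mult_left_mono)
  finally show ?thesis by (simp add: radius_def mult_right_mono)
qed

lemma slope_bound:
  assumes "t0 + real k * mesh n \<le> T"
  shows "norm (slope x0 n k) \<le> speed x0 T"
proof -
  have "norm (slope x0 n k) \<le> K * (1 + norm (euler x0 n k))"
    using growth[OF _ slope_in] mesh_pos[of n] by simp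
  also have "\<dots> \<le> K * radius x0 T"
    using euler_bound[OF assms] K_nonneg by (intro mult_left_mono)
  finally show ?thesis by (simp add: speed_def)
qed

lemma euler_diff:
  "j \<le> k \<Longrightarrow> euler x0 n k - euler x0 n j = mesh n *\<^sub>R (\<Sum>i\<in>{j..<k}. slope x0 n i)"
  by (induction k rule: dec_induct) (auto simp: slope_def scaleR_add_right algebra_simps)

lemma euler_lipschitz:
  assumes "j \<le> k" "t0 + real k * mesh n \<le> T"
  shows "norm (euler x0 n k - euler x0 n j) \<le> speed x0 T * (mesh n * (real k - real j))"
proof -
  have "norm (\<Sum>i\<in>{j..<k}. slope x0 n i) \<le> real (card {j..<k}) * speed x0 T"
  proof (rule sum_norm_bound)
    fix i assume "i \<in> {j..<k}"
    then have "real i * mesh n \<le> real k * mesh n" using mesh_pos[of n] by (intro mult_right_mono) auto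
    then show "norm (slope x0 n i) \<le> speed x0 T" using assms by (intro slope_bound) auto
  qed
  then show ?thesis
    using assms mesh_pos[of n] by (simp add: euler_diff of_nat_diff mult_ac)
qed

section \<open>Interpolation of the Euler points by step functions\<close>

definition index :: "nat \<Rightarrow> real \<Rightarrow> nat" where
  "index n t = nat \<lfloor>(t - t0) / mesh n\<rfloor>"

lemma index_bounds:
  assumes "t0 \<le> t"
  shows "t0 + real (index n t) * mesh n \<le> t" "t < t0 + (real (index n t) + 1) * mesh n"
proof -
  have "0 \<le> (t - t0) / mesh n" using assms mesh_pos[of n] by simp
  then have "real (index n t) \<le> (t - t0) / mesh n" "(t - t0) / mesh n < real (index n t) + 1"
    unfolding index_def by linarith+
  then show "t0 + real (index n t) * mesh n \<le> t" "t < t0 + (real (index n t) + 1) * mesh n"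
    using mesh_pos[of n] by (simp_all add: field_simps)
qed

lemma index_mono: "s \<le> t \<Longrightarrow> index n s \<le> index n t"
  unfolding index_def using mesh_pos[of n] by (intro nat_mono floor_mono divide_right_mono) auto

text \<open>Piecewise constant interpolation makes every value an Euler point. The price is
  discontinuity, which appears as the extra \<open>mesh n\<close> in the Lipschitz estimate and
  vanishes in the limit.\<close>

definition step_function :: "'a \<Rightarrow> nat \<Rightarrow> real \<Rightarrow> 'a" where
  "step_function x0 n t = euler x0 n (index n t)"

lemma step_function_bound:
  assumes "t0 \<le> t"
  shows "norm (step_function x0 n t) \<le> radius x0 t"
  using euler_bound[OF index_bounds(1)[OF assms], of x0 n] by (simp add: step_function_def)

lemma step_function_lipschitz:
  assumes "t0 \<le> s" "s \<le> t" "t \<le> T"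
  shows "norm (step_function x0 n t - step_function x0 n s) \<le> speed x0 T * (t - s + mesh n)"
proof -
  have "norm (step_function x0 n t - step_function x0 n s) \<le>
      speed x0 T * (mesh n * (real (index n t) - real (index n s)))"
    unfolding step_function_def
    using index_mono[OF assms(2)] index_bounds[of t n] assms by (intro euler_lipschitz) auto
  also have "\<dots> \<le> speed x0 T * (t - s + mesh n)"
    using index_bounds[of t n] index_bounds[of s n] assms
    by (intro mult_left_mono speed_nonneg) (auto simp: algebra_simps)
  finally show ?thesis .
qed

section \<open>Passage to the limit\<close>

text \<open>An Arzela-Ascoli argument for functions that are Lipschitz only up to the mesh: a
  diagonal subsequence converges at rational times, and the estimate transfers the Cauchy property
  to all times.\<close>

lemma convergent_subsequence:
  obtains r where "strict_mono r" "\<And>t. t0 \<le> t \<Longrightarrow> convergent (\<lambda>n. step_function x0 (r n) t)"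
proof -
  define S where "S = \<rat> \<inter> {t0..}"
  have "countable S" unfolding S_def by (intro countable_Int1 countable_rat)
  \<comment> \<open>The diagonal argument is applied with a bound common to all points, hence the
    division by the time-dependent radius.\<close>
  moreover have "norm (step_function x0 n t /\<^sub>R radius x0 t) \<le> 1" if "t \<in> S" for n t
    using step_function_bound[of t x0 n] radius_pos[of x0 t] that by (simp add: S_def field_simps)
  ultimately obtain r where r: "strict_mono r"
    and conv: "\<And>t. t \<in> S \<Longrightarrow> \<exists>l. (\<lambda>n. step_function x0 (r n) t /\<^sub>R radius x0 t) \<longlonglongrightarrow> l"
    using function_convergent_subsequence[of S "\<lambda>n t. step_function x0 n t /\<^sub>R radius x0 t" 1] by metis
  have rat: "Cauchy (\<lambda>n. step_function x0 (r n) t)" if t: "t \<in> S" for t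
  proof -
    obtain l where "(\<lambda>n. step_function x0 (r n) t /\<^sub>R radius x0 t) \<longlonglongrightarrow> l" using conv[OF t] by blast
    then have "(\<lambda>n. radius x0 t *\<^sub>R (step_function x0 (r n) t /\<^sub>R radius x0 t)) \<longlonglongrightarrow> radius x0 t *\<^sub>R l"
      by (intro tendsto_intros)
    then show ?thesis using radius_pos[of x0 t] by (simp add: LIMSEQ_imp_Cauchy)
  qed
  have "convergent (\<lambda>n. step_function x0 (r n) t)" if t: "t0 \<le> t" for t
  proof (rule Cauchy_convergent, rule metric_CauchyI)
    fix e :: real assume "e > 0"
    define M where "M = speed x0 (t + 1) + 1"
    have M: "M > 0" "speed x0 (t + 1) \<le> M" using speed_nonneg[of x0 "t + 1"] by (auto simp: M_def)
    \<comment> \<open>Choosing \<open>q\<close> to the right of \<open>t\<close> keeps it in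
      \<open>S\<close>. The gap and the mesh each contribute at most \<open>e / 8\<close>, so moving
      from \<open>q\<close> to \<open>t\<close> costs less than \<open>e / 4\<close>.\<close>
    obtain q where q: "q \<in> \<rat>" "t < q" "q < t + min 1 (e / (8 * M))"
      using Rats_dense_in_real[of t "t + min 1 (e / (8 * M))"] \<open>e > 0\<close> M by auto
    then have "q \<in> S" using t by (auto simp: S_def)
    then obtain N1 where N1: "\<And>m n. m \<ge> N1 \<Longrightarrow> n \<ge> N1 \<Longrightarrow> dist (step_function x0 (r m) q) (step_function x0 (r n) q) < e / 4"
      using metric_CauchyD[OF rat, of q "e / 4"] \<open>e > 0\<close> by auto
    have "(mesh \<circ> r) \<longlonglongrightarrow> 0" using mesh_tendsto r LIMSEQ_subseq_LIMSEQ by blast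
    then have "\<forall>\<^sub>F n in sequentially. (mesh \<circ> r) n < e / (8 * M)"
      using \<open>e > 0\<close> M by (intro order_tendstoD(2)[OF \<open>(mesh \<circ> r) \<longlonglongrightarrow> 0\<close>]) simp
    then obtain N2 where N2: "\<And>n. n \<ge> N2 \<Longrightarrow> mesh (r n) < e / (8 * M)"
      by (auto simp: eventually_sequentially)
    have near: "dist (step_function x0 (r n) q) (step_function x0 (r n) t) < e / 4" if "n \<ge> N2" for n
    proof -
      have "dist (step_function x0 (r n) q) (step_function x0 (r n) t) \<le> speed x0 (t + 1) * (q - t + mesh (r n))"
        unfolding dist_norm using q t by (intro step_function_lipschitz) auto
      also have "\<dots> \<le> M * (q - t + mesh (r n))"
        using M q mesh_pos[of "r n"] by (intro mult_right_mono) auto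
      also have "\<dots> < M * (e / (8 * M) + e / (8 * M))"
        using N2[OF that] M q by (intro mult_strict_left_mono) auto
      also have "\<dots> = e / 4" using M by (simp add: field_simps)
      finally show ?thesis .
    qed
    have "dist (step_function x0 (r m) t) (step_function x0 (r n) t) < e" if "m \<ge> max N1 N2" "n \<ge> max N1 N2" for m n
      using near[of m] near[of n] N1[of m n] that \<open>e > 0\<close>
        dist_triangle[of "step_function x0 (r m) t" "step_function x0 (r n) t" "step_function x0 (r m) q"]
        dist_triangle[of "step_function x0 (r m) q" "step_function x0 (r n) t" "step_function x0 (r n) q"]
      by (simp add: dist_commute)
    then show "\<exists>N. \<forall>m\<ge>N. \<forall>n\<ge>N. dist (step_function x0 (r m) t) (step_function x0 (r n) t) < e" by blast
  qed
  with r that show thesis by blast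
qed

text \<open>The increment is a sum of Euler steps whose slopes all lie in the
  \<open>e\<close>-neighbourhood of \<open>F t x\<close>; by convexity so does their mean. The
  factor \<open>c\<close> is the time covered by these steps, which differs from
  \<open>\<eta>\<close> by at most one mesh.\<close>

lemma average_slope_near:
  assumes t: "t0 \<le> t" and \<eta>: "0 < \<eta>" "\<eta> \<le> 1" "\<eta> < \<delta>" and mesh: "mesh n \<le> \<eta>"
    and usc: "\<And>s z y. \<lbrakk>t0 \<le> s; \<bar>s - t\<bar> < \<delta>; norm (z - x) < \<delta>; y \<in> F s z\<rbrakk> \<Longrightarrow> \<exists>y'\<in>F t x. norm (y - y') \<le> e"
    and near: "norm (step_function x0 n t - x) + speed x0 (t + 1) * (\<eta> + mesh n) < \<delta>"
  obtains c y where "\<bar>c - \<eta>\<bar> \<le> mesh n" "y \<in> F t x"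
    "norm (step_function x0 n (t + \<eta>) - step_function x0 n t - c *\<^sub>R y) \<le> c * e" "c > 0"
proof -
  define j k where "j = index n t" and "k = index n (t + \<eta>)"
  have j: "t0 + real j * mesh n \<le> t" "t < t0 + (real j + 1) * mesh n"
    using index_bounds[OF t] by (simp_all add: j_def)
  have k: "t0 + real k * mesh n \<le> t + \<eta>" "t + \<eta> < t0 + (real k + 1) * mesh n"
    using index_bounds[of "t + \<eta>"] t \<eta> by (simp_all add: k_def)
  \<comment> \<open>Since \<open>mesh n \<le> \<eta>\<close>, at least one Euler step is made, so
    the average is over a nonempty range.\<close>
  have "real j * mesh n < real k * mesh n"
    using j(1) k(2) mesh unfolding distrib_right mult_1_left by linarith
  then have "j < k" using mesh_pos[of n] by simp
  \<comment> \<open>The closed \<open>e\<close>-neighbourhood is written as a Minkowski sum with a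
    ball, from which its convexity is immediate.\<close>
  define C where "C = (\<Union>y\<in>F t x. \<Union>w\<in>cball 0 e. {y + w})"
  have "convex C"
    unfolding C_def using convex_values[OF t] by (intro convex_sums) auto
  have slopes: "slope x0 n i \<in> C" if i: "i \<in> {j..<k}" for i
  proof -
    have ij: "real j * mesh n \<le> real i * mesh n" using i mesh_pos[of n] by (intro mult_right_mono) auto
    have ik: "(real i + 1) * mesh n \<le> real k * mesh n" using i mesh_pos[of n] by (intro mult_right_mono) auto
    have "norm (euler x0 n i - euler x0 n j) \<le> speed x0 (t + 1) * (mesh n * (real i - real j))"
      using i ik k \<eta> mesh_pos[of n] by (intro euler_lipschitz) (auto simp: algebra_simps)
    also have "\<dots> \<le> speed x0 (t + 1) * (\<eta> + mesh n)"
      using j k ik mesh_pos[of n] by (intro mult_left_mono speed_nonneg) (simp add: algebra_simps)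
    finally have "norm (euler x0 n i - x) < \<delta>"
      using near norm_triangle_ineq[of "euler x0 n i - euler x0 n j" "euler x0 n j - x"]
      by (simp add: step_function_def j_def)
    moreover have "\<bar>t0 + real i * mesh n - t\<bar> < \<delta>"
      using ij ik j k mesh \<eta> mesh_pos[of n] unfolding distrib_right mult_1_left abs_less_iff by linarith
    moreover have "t0 \<le> t0 + real i * mesh n" using mesh_pos[of n] by simp
    ultimately obtain y where "y \<in> F t x" "norm (slope x0 n i - y) \<le> e"
      using usc slope_in by blast
    then have "slope x0 n i = y + (slope x0 n i - y)" "slope x0 n i - y \<in> cball 0 e" by auto
    with \<open>y \<in> F t x\<close> show ?thesis unfolding C_def by blast
  qed
  define m where "m = real (k - j)"
  have m: "m > 0" "m = real k - real j" using \<open>j < k\<close> by (auto simp: m_def)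
  have "(\<Sum>i\<in>{j..<k}. (1 / m) *\<^sub>R slope x0 n i) \<in> C"
    using slopes m \<open>j < k\<close> by (intro convex_sum \<open>convex C\<close>) (auto simp: m_def)
  then obtain y w where yw: "y \<in> F t x" "norm w \<le> e" "(\<Sum>i\<in>{j..<k}. (1 / m) *\<^sub>R slope x0 n i) = y + w"
    unfolding C_def by auto
  have "step_function x0 n (t + \<eta>) - step_function x0 n t = mesh n *\<^sub>R (\<Sum>i\<in>{j..<k}. slope x0 n i)"
    using \<open>j < k\<close> by (simp add: step_function_def euler_diff flip: j_def k_def)
  also have "\<dots> = (mesh n * m) *\<^sub>R (\<Sum>i\<in>{j..<k}. (1 / m) *\<^sub>R slope x0 n i)"
    using m by (simp flip: scaleR_right.sum)
  finally have "step_function x0 n (t + \<eta>) - step_function x0 n t - (mesh n * m) *\<^sub>R y = (mesh n * m) *\<^sub>R w"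
    by (simp add: yw algebra_simps)
  then have "norm (step_function x0 n (t + \<eta>) - step_function x0 n t - (mesh n * m) *\<^sub>R y) \<le> mesh n * m * e"
    using yw m mesh_pos[of n] by (simp add: mult_left_mono)
  moreover have "\<bar>mesh n * m - \<eta>\<bar> \<le> mesh n"
    using j k unfolding m(2) right_diff_distrib distrib_right mult_1_left abs_le_iff mult.commute[of "mesh n"] by linarith
  moreover have "mesh n * m > 0" using m mesh_pos by simp
  ultimately show thesis using that yw by blast
qed

text \<open>The inclusion holds at every point of differentiability after \<open>t0\<close>; the
  exceptional null set enters only through the differentiability of Lipschitz functions.\<close>

lemma solution_exists_differentiable:
  obtains x where "x t0 = x0" "\<And>T. (speed x0 T)-lipschitz_on {t0..T} x"
    "\<And>t d. t0 < t \<Longrightarrow> (x has_vector_derivative d) (at t) \<Longrightarrow> d \<in> F t (x t)"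
proof -
  obtain r where r: "strict_mono r" and conv: "\<And>t. t0 \<le> t \<Longrightarrow> convergent (\<lambda>n. step_function x0 (r n) t)"
    using convergent_subsequence[of x0] by blast
  define x where "x t = lim (\<lambda>n. step_function x0 (r n) t)" for t
  have x: "(\<lambda>n. step_function x0 (r n) t) \<longlonglongrightarrow> x t" if "t0 \<le> t" for t
    using conv[OF that] by (simp add: x_def convergent_LIMSEQ_iff)
  have mesh0: "(\<lambda>n. mesh (r n)) \<longlonglongrightarrow> 0"
    using LIMSEQ_subseq_LIMSEQ[OF mesh_tendsto r] by (simp add: o_def)
  show thesis
  proof
    have "index n t0 = 0" for n by (simp add: index_def)
    then have "step_function x0 n t0 = x0" for n by (simp add: step_function_def)
    then show "x t0 = x0" by (simp add: x_def)
    have lip: "norm (x t - x s) \<le> speed x0 T * (t - s)" if st: "t0 \<le> s" "s \<le> t" "t \<le> T" for s t T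
    proof (rule tendsto_le[OF trivial_limit_sequentially])
      have "(\<lambda>n. speed x0 T * (t - s + mesh (r n))) \<longlonglongrightarrow> speed x0 T * (t - s + 0)"
        by (intro tendsto_intros mesh0)
      then show "(\<lambda>n. speed x0 T * (t - s + mesh (r n))) \<longlonglongrightarrow> speed x0 T * (t - s)" by simp
      show "(\<lambda>n. norm (step_function x0 (r n) t - step_function x0 (r n) s)) \<longlonglongrightarrow> norm (x t - x s)"
        using st by (intro tendsto_intros x) auto
    qed (use step_function_lipschitz[OF st] in simp)
    show "(speed x0 T)-lipschitz_on {t0..T} x" for T
    proof (rule lipschitz_onI)
      show "dist (x s) (x t) \<le> speed x0 T * dist s t" if "s \<in> {t0..T}" "t \<in> {t0..T}" for s t
        using lip[of s t T] lip[of t s T] that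
        by (cases "s \<le> t") (auto simp: dist_norm norm_minus_commute)
    qed (rule speed_nonneg)
    show "d \<in> F t (x t)" if t: "t0 < t" and d: "(x has_vector_derivative d) (at t)" for t d
    proof -
      have "\<exists>y\<in>F t (x t). dist y d < e" if "e > 0" for e
      proof -
        define M where "M = speed x0 (t + 1)"
        have M: "M \<ge> 0" using speed_nonneg by (simp add: M_def)
        obtain \<delta> where \<delta>: "\<delta> > 0"
          and usc: "\<And>s z y. \<lbrakk>t0 \<le> s; \<bar>s - t\<bar> < \<delta>; norm (z - x t) < \<delta>; y \<in> F s z\<rbrakk> \<Longrightarrow> \<exists>y'\<in>F t (x t). norm (y - y') \<le> e / 8"
          using upper_semicontinuous[of t "e / 8" "x t"] t \<open>e > 0\<close> by auto
        obtain \<gamma> where \<gamma>: "\<gamma> > 0"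
          and deriv: "\<And>s. \<bar>s - t\<bar> < \<gamma> \<Longrightarrow> norm (x s - x t - (s - t) *\<^sub>R d) \<le> e / 32 * \<bar>s - t\<bar>"
          using d[unfolded has_vector_derivative_def has_derivative_at_alt, THEN conjunct2, rule_format, of "e / 32"] \<open>e > 0\<close>
          by auto
        \<comment> \<open>The bounds keep the window within the range of
          \<open>speed x0 (t + 1)\<close>, of the derivative estimate and of semicontinuity in time;
          the last one limits the drift of the Euler points to \<open>\<delta> / 4\<close>.\<close>
        define \<eta> where "\<eta> = min (min 1 (\<gamma> / 2)) (min (\<delta> / 2) (\<delta> / (8 * (M + 1))))"
        have "\<delta> / (8 * (M + 1)) > 0" using \<delta> M by simp
        then have \<eta>: "0 < \<eta>" "\<eta> \<le> 1" "\<eta> < \<gamma>" "\<eta> < \<delta>" "\<eta> \<le> \<delta> / (8 * (M + 1))"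
          using \<gamma> \<delta> \<open>\<delta> / (8 * (M + 1)) > 0\<close> unfolding \<eta>_def by linarith+
        have "M * (2 * \<eta>) \<le> (M + 1) * (2 * (\<delta> / (8 * (M + 1))))"
          using M \<eta> by (intro mult_mono) auto
        also have "\<dots> = \<delta> / 4" using M by (simp add: divide_simps)
        finally have M\<eta>: "M * (2 * \<eta>) \<le> \<delta> / 4" .
        \<comment> \<open>Four errors of size \<open>\<rho>\<close> add up to
          \<open>\<eta> * e / 8\<close>. Below, \<open>mesh (r n) < \<eta> / 2\<close> ensures
          \<open>\<eta> \<le> 2 * c\<close>, and the bound \<open>\<rho> / (norm d + e)\<close>
          controls the replacement of \<open>\<eta>\<close> by \<open>c\<close>; the summand
          \<open>e\<close> covers the case \<open>d = 0\<close>.\<close>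
        define \<rho> where "\<rho> = \<eta> * e / 32"
        have "\<rho> > 0" using \<eta> \<open>e > 0\<close> by (simp add: \<rho>_def)
        have "\<forall>\<^sub>F n in sequentially. mesh (r n) < min (\<eta> / 2) (\<rho> / (norm d + e))"
          using \<eta> \<open>\<rho> > 0\<close> \<open>e > 0\<close> by (intro order_tendstoD(2)[OF mesh0]) (auto intro!: divide_pos_pos add_nonneg_pos)
        moreover have "\<forall>\<^sub>F n in sequentially. norm (step_function x0 (r n) t - x t) < min (\<delta> / 4) \<rho>"
          using tendstoD[OF x[of t], of "min (\<delta> / 4) \<rho>"] t \<delta> \<open>\<rho> > 0\<close> by (simp add: dist_norm)
        moreover have "\<forall>\<^sub>F n in sequentially. norm (step_function x0 (r n) (t + \<eta>) - x (t + \<eta>)) < \<rho>"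
          using tendstoD[OF x[of "t + \<eta>"], of \<rho>] t \<eta> \<open>\<rho> > 0\<close> by (simp add: dist_norm)
        ultimately have "\<forall>\<^sub>F n in sequentially. mesh (r n) < min (\<eta> / 2) (\<rho> / (norm d + e)) \<and>
            norm (step_function x0 (r n) t - x t) < min (\<delta> / 4) \<rho> \<and>
            norm (step_function x0 (r n) (t + \<eta>) - x (t + \<eta>)) < \<rho>"
          by eventually_elim simp
        then obtain n where n: "mesh (r n) < \<eta> / 2" "mesh (r n) < \<rho> / (norm d + e)"
            "norm (step_function x0 (r n) t - x t) < \<delta> / 4" "norm (step_function x0 (r n) t - x t) < \<rho>"
            "norm (step_function x0 (r n) (t + \<eta>) - x (t + \<eta>)) < \<rho>"
          by (auto dest!: eventually_happens'[OF sequentially_bot])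
        have "M * (\<eta> + mesh (r n)) \<le> M * (2 * \<eta>)" using n \<eta> M by (intro mult_left_mono) auto
        then have "norm (step_function x0 (r n) t - x t) + speed x0 (t + 1) * (\<eta> + mesh (r n)) < \<delta>"
          using M\<eta> n \<delta> by (simp add: M_def)
        then obtain c y where c: "\<bar>c - \<eta>\<bar> \<le> mesh (r n)" "c > 0" and y: "y \<in> F t (x t)"
          and avg: "norm (step_function x0 (r n) (t + \<eta>) - step_function x0 (r n) t - c *\<^sub>R y) \<le> c * (e / 8)"
          using average_slope_near[of t \<eta> \<delta> "r n" "x t" "e / 8" x0] t \<eta> n(1) usc
          by (smt (verit) field_sum_of_halves)
        define a where "a = step_function x0 (r n) (t + \<eta>) - step_function x0 (r n) t"
        have 1: "norm (a - (x (t + \<eta>) - x t)) \<le> 2 * \<rho>"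
          using norm_triangle_ineq4[of "step_function x0 (r n) (t + \<eta>) - x (t + \<eta>)" "step_function x0 (r n) t - x t"] n
          by (simp add: a_def algebra_simps)
        have 2: "norm (x (t + \<eta>) - x t - \<eta> *\<^sub>R d) \<le> \<rho>"
          using deriv[of "t + \<eta>"] \<eta> by (simp add: \<rho>_def mult_ac)
        have 3: "norm (\<eta> *\<^sub>R d - c *\<^sub>R d) \<le> \<rho>"
        proof -
          have "norm (\<eta> *\<^sub>R d - c *\<^sub>R d) = \<bar>c - \<eta>\<bar> * norm d"
            by (simp add: abs_minus_commute flip: scaleR_diff_left)
          also have "\<dots> \<le> \<rho> / (norm d + e) * (norm d + e)"
            using c n \<open>e > 0\<close> by (intro mult_mono) auto
          also have "\<dots> = \<rho>" using \<open>e > 0\<close> by (simp add: add_nonneg_pos order_less_imp_not_eq2)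
          finally show ?thesis .
        qed
        have "norm (c *\<^sub>R y - c *\<^sub>R d) \<le> c * (e / 8) + 2 * \<rho> + \<rho> + \<rho>"
        proof -
          \<comment> \<open>The four terms are the averaging error, the convergence error at both
            ends of the window, the differentiation error and the mismatch of \<open>c\<close> and
            \<open>\<eta>\<close>.\<close>
          have "c *\<^sub>R y - c *\<^sub>R d = - (a - c *\<^sub>R y) + (a - (x (t + \<eta>) - x t)) + (x (t + \<eta>) - x t - \<eta> *\<^sub>R d) + (\<eta> *\<^sub>R d - c *\<^sub>R d)"
            by simp
          then show ?thesis
            using avg 1 2 3 by (metis (no_types, lifting) a_def norm_minus_cancel norm_triangle_mono)
        qed
        then have cyd: "c * dist y d \<le> c * (e / 8) + \<eta> * (e / 8)"
          using c by (simp add: dist_norm \<rho>_def flip: scaleR_diff_right)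
        have "\<eta> * (e / 8) \<le> (2 * c) * (e / 8)"
          using c n(1) \<open>e > 0\<close> by (intro mult_right_mono) auto
        with cyd have "c * dist y d \<le> c * (3 * e / 8)" by (simp add: algebra_simps)
        then have "dist y d \<le> 3 * e / 8" using c by simp
        then show ?thesis using y \<open>e > 0\<close> by (intro bexI[of _ y]) auto
      qed
      then have "d \<in> closure (F t (x t))" by (auto simp: closure_approachable)
      then show ?thesis using closed_values[of t] t by simp
    qed
  qed
qed

theorem solution_exists:
  obtains x where "x t0 = x0" "\<And>T. \<exists>L. L-lipschitz_on {t0..T} x"
    "AE t in lborel. t > t0 \<longrightarrow> (\<exists>d\<in>F t (x t). (x has_vector_derivative d) (at t))"
proof -
  obtain x where x: "x t0 = x0" "\<And>T. (speed x0 T)-lipschitz_on {t0..T} x"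
    "\<And>t d. t0 < t \<Longrightarrow> (x has_vector_derivative d) (at t) \<Longrightarrow> d \<in> F t (x t)"
    using solution_exists_differentiable[of x0] by blast
  have "AE t in lborel. t > t0 \<longrightarrow> x differentiable at t"
    using x(2) by (intro AE_differentiable_locally_lipschitz) blast
  then have "AE t in lborel. t > t0 \<longrightarrow> (\<exists>d\<in>F t (x t). (x has_vector_derivative d) (at t))"
    by (rule AE_mp, intro AE_I2 impI) (use x(3) vector_derivative_works in blast)
  with x(1,2) that show thesis by blast
qed

end

section \<open>The map \<open>G\<close>\<close>

lemma lipschitz_on_imp_abs_continuous_on:
  fixes f :: "real \<Rightarrow> 'a::real_normed_vector"
  assumes L: "L-lipschitz_on S f"
  shows "abs_continuous_on S f"
  unfolding abs_continuous_on_def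
proof (intro allI impI)
  fix e :: real assume "e > 0"
  have L0: "L \<ge> 0" using L by (rule lipschitz_on_nonneg)
  \<comment> \<open>The constant \<open>L + 1\<close> is safe to divide by even when
    \<open>L = 0\<close>.\<close>
  have "(\<Sum>i<n. norm (f (b i) - f (a i))) < e"
    if ab: "\<forall>i<n. a i \<le> b i \<and> {a i..b i} \<subseteq> S" and sum: "(\<Sum>i<n. b i - a i) < e / (L + 1)"
    for n :: nat and a b :: "nat \<Rightarrow> real"
  proof -
    have "(\<Sum>i<n. norm (f (b i) - f (a i))) \<le> (\<Sum>i<n. (L + 1) * (b i - a i))"
    proof (rule sum_mono)
      fix i assume "i \<in> {..<n}"
      then have i: "a i \<le> b i" "{a i..b i} \<subseteq> S" using ab by auto
      then have "b i \<in> S" "a i \<in> S" by (meson atLeastAtMost_iff order_refl subsetD)+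
      then have "norm (f (b i) - f (a i)) \<le> L * (b i - a i)"
        using lipschitz_onD[OF L, of "b i" "a i"] i by (simp add: dist_norm)
      also have "\<dots> \<le> (L + 1) * (b i - a i)" using i by (intro mult_right_mono) auto
      finally show "norm (f (b i) - f (a i)) \<le> (L + 1) * (b i - a i)" .
    qed
    also have "\<dots> = (L + 1) * (\<Sum>i<n. b i - a i)" by (simp add: sum_distrib_left)
    also have "\<dots> < (L + 1) * (e / (L + 1))" using sum L0 by (intro mult_strict_left_mono) auto
    also have "\<dots> = e" using L0 by simp
    finally show ?thesis .
  qed
  moreover have "e / (L + 1) > 0" using \<open>e > 0\<close> L0 by simp
  ultimately show "\<exists>\<delta>>0. \<forall>(n::nat) (a::nat \<Rightarrow> real) (b::nat \<Rightarrow> real). (\<forall>i<n. a i \<le> b i \<and> {a i..b i} \<subseteq> S) \<and>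
      (\<forall>i<n. \<forall>j<n. i \<noteq> j \<longrightarrow> {a i<..<b i} \<inter> {a j<..<b j} = {}) \<and> (\<Sum>i<n. b i - a i) < \<delta>
      \<longrightarrow> (\<Sum>i<n. norm (f (b i) - f (a i))) < e"
    by blast
qed

section \<open>The convex hull of the gradients and its minimising faces\<close>

lemma Cset_eq_hull_image: "Cset m df u = convex hull ((\<lambda>i. df i u) ` {1..m})"
  unfolding Cset_def by (rule arg_cong[where f = "(hull) convex"]) auto

lemma Cset_subsetI:
  assumes "convex S" "\<And>i. i \<in> {1..m} \<Longrightarrow> df i u \<in> S"
  shows "Cset m df u \<subseteq> S"
  unfolding Cset_eq_hull_image using assms by (intro hull_minimal) auto

lemma df_in_Cset: "i \<in> {1..m} \<Longrightarrow> df i u \<in> Cset m df u"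
  unfolding Cset_eq_hull_image by (intro hull_inc imageI)

text \<open>A half-space argument gives one direction, and separation from the compact hull gives
  the other. For fixed \<open>p\<close> the condition is a finite union of inequalities continuous
  in \<open>u\<close> and \<open>g\<close> when the gradients are continuous, hence closed.\<close>

lemma mem_Cset_iff:
  fixes df :: "nat \<Rightarrow> 'a \<Rightarrow> 'a::euclidean_space"
  shows "g \<in> Cset m df u \<longleftrightarrow> (\<forall>p. \<exists>i\<in>{1..m}. g \<bullet> p \<le> df i u \<bullet> p)"
proof
  assume g: "g \<in> Cset m df u"
  show "\<forall>p. \<exists>i\<in>{1..m}. g \<bullet> p \<le> df i u \<bullet> p"
  proof (rule ccontr)
    assume "\<not> ?thesis"
    then obtain p where "\<forall>i\<in>{1..m}. \<not> g \<bullet> p \<le> df i u \<bullet> p" by blast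
    then have p: "p \<bullet> df i u < p \<bullet> g" if "i \<in> {1..m}" for i
      using that by (simp add: not_le inner_commute)
    have "Cset m df u \<subseteq> {x. p \<bullet> x < p \<bullet> g}"
      using p by (intro Cset_subsetI convex_halfspace_lt) auto
    with g show False by auto
  qed
next
  assume R: "\<forall>p. \<exists>i\<in>{1..m}. g \<bullet> p \<le> df i u \<bullet> p"
  show "g \<in> Cset m df u"
  proof (rule ccontr)
    assume "g \<notin> Cset m df u"
    moreover have "convex (Cset m df u)" "closed (Cset m df u)"
      unfolding Cset_eq_hull_image
      by (auto intro!: compact_imp_closed finite_imp_compact_convex_hull)
    ultimately have "\<exists>a b. a \<bullet> g < b \<and> (\<forall>x\<in>Cset m df u. a \<bullet> x > b)"
      by (intro separating_hyperplane_closed_point)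
    then obtain a b where ab: "a \<bullet> g < b" "\<And>x. x \<in> Cset m df u \<Longrightarrow> a \<bullet> x > b" by blast
    obtain i where "i \<in> {1..m}" "g \<bullet> (- a) \<le> df i u \<bullet> (- a)" using R by blast
    with ab(1) ab(2)[OF df_in_Cset[of i m df u]] show False by (simp add: inner_commute)
  qed
qed

text \<open>Minimising against \<open>- v\<close> means maximising against \<open>v\<close>, and a
  linear functional on a convex hull has to be compared only with the generators.\<close>

lemma mem_argmin_Cset_iff:
  fixes df :: "nat \<Rightarrow> 'a \<Rightarrow> 'a::euclidean_space"
  shows "g \<in> argmin_set (\<lambda>g. g \<bullet> (- v)) (Cset m df u) \<longleftrightarrow>
    (\<forall>p. \<exists>i\<in>{1..m}. g \<bullet> p \<le> df i u \<bullet> p) \<and> (\<forall>i\<in>{1..m}. df i u \<bullet> v \<le> g \<bullet> v)"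
proof -
  have "(\<forall>y\<in>Cset m df u. y \<bullet> v \<le> g \<bullet> v) \<longleftrightarrow> (\<forall>i\<in>{1..m}. df i u \<bullet> v \<le> g \<bullet> v)"
  proof
    assume "\<forall>i\<in>{1..m}. df i u \<bullet> v \<le> g \<bullet> v"
    then have "Cset m df u \<subseteq> {x. v \<bullet> x \<le> v \<bullet> g}"
      by (intro Cset_subsetI convex_halfspace_le) (auto simp: inner_commute)
    then show "\<forall>y\<in>Cset m df u. y \<bullet> v \<le> g \<bullet> v" by (auto simp: inner_commute)
  qed (use df_in_Cset in blast)
  then show ?thesis by (simp add: argmin_set_def mem_Cset_iff)
qed

section \<open>Convexity, closed graph and linear growth of the right-hand side\<close>

lemma mem_Gmap_iff:
  "y \<in> Gmap \<alpha> m df t u v \<longleftrightarrow> fst y = v \<and>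
    - (\<alpha> / t) *\<^sub>R v - snd y \<in> argmin_set (\<lambda>g. g \<bullet> (- v)) (Cset m df u)"
  unfolding Gmap_def by (cases y) force

lemma convex_argmin_Cset: "convex (argmin_set (\<lambda>g. g \<bullet> v) (Cset m df u))"
proof -
  have "argmin_set (\<lambda>g. g \<bullet> v) (Cset m df u) = Cset m df u \<inter> (\<Inter>y\<in>Cset m df u. {x. v \<bullet> x \<le> v \<bullet> y})"
    by (auto simp: argmin_set_def inner_commute)
  moreover have "convex (Cset m df u)" unfolding Cset_def by simp
  ultimately show ?thesis by (auto intro!: convex_Int convex_INT convex_halfspace_le)
qed

lemma convex_Gmap: "convex (Gmap \<alpha> m df t u v)"
proof -
  have "Gmap \<alpha> m df t u v = {v} \<times> ((\<lambda>g. - (\<alpha> / t) *\<^sub>R v - g) ` argmin_set (\<lambda>g. g \<bullet> (- v)) (Cset m df u))"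
    unfolding Gmap_def by auto
  moreover have "convex ((\<lambda>g. - (\<alpha> / t) *\<^sub>R v - g) ` argmin_set (\<lambda>g. g \<bullet> (- v)) (Cset m df u))"
    using convex_translation[OF convex_negations[OF convex_argmin_Cset], of "- (\<alpha> / t) *\<^sub>R v" "- v" m df u]
    by (simp only: image_image diff_conv_add_uminus)
  ultimately show ?thesis by (simp add: convex_Times)
qed

text \<open>A generator with the largest inner product with \<open>v\<close> is already a minimiser
  over the whole hull.\<close>

lemma Gmap_nonempty:
  fixes df :: "nat \<Rightarrow> 'a \<Rightarrow> 'a::euclidean_space"
  assumes "m \<ge> 1"
  shows "Gmap \<alpha> m df t u v \<noteq> {}"
proof -
  obtain i where i: "i \<in> {1..m}" "\<And>j. j \<in> {1..m} \<Longrightarrow> df j u \<bullet> v \<le> df i u \<bullet> v"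
  proof -
    let ?S = "(\<lambda>i. df i u \<bullet> v) ` {1..m}"
    have "Max ?S \<in> ?S" using assms by (intro Max_in) auto
    then obtain i where "i \<in> {1..m}" "Max ?S = df i u \<bullet> v" by blast
    moreover have "df j u \<bullet> v \<le> Max ?S" if "j \<in> {1..m}" for j
      using that by (intro Max_ge) auto
    ultimately show thesis using that by metis
  qed
  then have "df i u \<in> argmin_set (\<lambda>g. g \<bullet> (- v)) (Cset m df u)"
    unfolding mem_argmin_Cset_iff by auto
  then show ?thesis unfolding Gmap_def by auto
qed

lemma closed_graph_Gmap:
  fixes df :: "nat \<Rightarrow> 'a \<Rightarrow> 'a::euclidean_space"
  assumes "\<And>i. i \<in> {1..m} \<Longrightarrow> continuous_on UNIV (df i)" and "t0 > 0"
  shows "closed {(t, x, y). t0 \<le> t \<and> y \<in> Gmap \<alpha> m df t (fst x) (snd x)}"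
proof -
  \<comment> \<open>The function \<open>g\<close> recovers the element of the hull from a point of
    the graph. Writing \<open>max t0\<close> for the time makes the quotient continuous on the whole
    space and changes nothing for \<open>t0 \<le> t\<close>.\<close>
  define u v g where "u z = fst (fst (snd z))" and "v z = snd (fst (snd z))"
    and "g z = - (\<alpha> / max t0 (fst z)) *\<^sub>R snd (fst (snd z)) - snd (snd (snd z))"
    for z :: "real \<times> ('a \<times> 'a) \<times> ('a \<times> 'a)"
  have "{(t, x, y). t0 \<le> t \<and> y \<in> Gmap \<alpha> m df t (fst x) (snd x)} =
    {z. t0 \<le> fst z \<and> fst (snd (snd z)) = v z \<and> (\<forall>p. z \<in> (\<Union>i\<in>{1..m}. {z. g z \<bullet> p \<le> df i (u z) \<bullet> p})) \<and>
        (\<forall>i. i \<in> {1..m} \<longrightarrow> df i (u z) \<bullet> v z \<le> g z \<bullet> v z)}"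
    unfolding mem_Gmap_iff mem_argmin_Cset_iff u_def v_def g_def by (auto simp: max_def)
  also have "closed \<dots>"
  proof -
    have cont: "continuous_on UNIV g" "continuous_on UNIV u" "continuous_on UNIV v"
      unfolding u_def v_def g_def using \<open>t0 > 0\<close> by (auto intro!: continuous_intros)
    have df: "continuous_on UNIV (\<lambda>z. df i (u z))" if "i \<in> {1..m}" for i
      using continuous_on_compose2[OF assms(1)[OF that] cont(2)] by simp
    have "closed {z. i \<in> {1..m} \<longrightarrow> df i (u z) \<bullet> v z \<le> g z \<bullet> v z}" for i
      using df[of i] cont
      by (cases "i \<in> {1..m}") (auto intro!: closed_Collect_le continuous_intros simp del: atLeastAtMost_iff)
    moreover have "closed {z. z \<in> (\<Union>i\<in>{1..m}. {z. g z \<bullet> p \<le> df i (u z) \<bullet> p})}" for p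
      unfolding Collect_mem_eq using df cont
      by (intro closed_UN) (auto intro!: closed_Collect_le continuous_intros simp del: atLeastAtMost_iff)
    ultimately show ?thesis
      using cont by (intro closed_Collect_conj closed_Collect_all closed_Collect_le closed_Collect_eq continuous_intros)
  qed
  finally show ?thesis .
qed

text \<open>Lipschitz gradients grow at most linearly, and balls are convex, so the hull obeys the
  same bound; the damping coefficient is at most \<open>\<alpha> / t0\<close>.\<close>

lemma Gmap_linear_growth:
  fixes df :: "nat \<Rightarrow> 'a \<Rightarrow> 'a::euclidean_space"
  assumes lip: "\<And>i. i \<in> {1..m} \<Longrightarrow> \<exists>L. L-lipschitz_on UNIV (df i)" and "\<alpha> > 0" "t0 > 0"
  obtains K where "K \<ge> 0"
    "\<And>t x y. t0 \<le> t \<Longrightarrow> y \<in> Gmap \<alpha> m df t (fst x) (snd x) \<Longrightarrow> norm y \<le> K * (1 + norm x)"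
proof -
  obtain L where L: "\<And>i. i \<in> {1..m} \<Longrightarrow> (L i)-lipschitz_on UNIV (df i)" using lip by metis
  have L0: "L i \<ge> 0" if "i \<in> {1..m}" for i using L[OF that] by (rule lipschitz_on_nonneg)
  define R where "R = (\<Sum>i\<in>{1..m}. L i + norm (df i 0))"
  have "R \<ge> 0" unfolding R_def using L0 by (intro sum_nonneg) auto
  have "norm (df i u) \<le> R * (1 + norm u)" if i: "i \<in> {1..m}" for i u
  proof -
    have "norm (df i u) \<le> norm (df i 0) + L i * norm u"
      using lipschitz_onD[OF L[OF i], of u 0] norm_triangle_sub[of "df i u" "df i 0"] by (simp add: dist_norm)
    also have "\<dots> \<le> (L i + norm (df i 0)) * (1 + norm u)"
      using L0[OF i] by (simp add: algebra_simps)
    also have "L i + norm (df i 0) \<le> R"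
      unfolding R_def using L0 i by (intro member_le_sum) auto
    finally show ?thesis by (simp add: mult_right_mono)
  qed
  then have C: "Cset m df u \<subseteq> cball 0 (R * (1 + norm u))" for u
    by (intro Cset_subsetI convex_cball) auto
  show thesis
  proof
    \<comment> \<open>The three summands account for the velocity component, the damping term and
      the hull element.\<close>
    show "1 + \<alpha> / t0 + R \<ge> 0" using \<open>R \<ge> 0\<close> assms by simp
    fix t and x y :: "'a \<times> 'a"
    assume t: "t0 \<le> t" and y: "y \<in> Gmap \<alpha> m df t (fst x) (snd x)"
    define g where "g = - (\<alpha> / t) *\<^sub>R snd x - snd y"
    have y1: "fst y = snd x" and "g \<in> Cset m df (fst x)"
      using y unfolding mem_Gmap_iff g_def argmin_set_def by auto
    then have "norm g \<le> R * (1 + norm (fst x))" using C[of "fst x"] by (auto simp: subset_iff)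
    also have "\<dots> \<le> R * (1 + norm x)"
      using \<open>R \<ge> 0\<close> norm_fst_le[of "fst x" "snd x"] by (intro mult_left_mono) auto
    finally have g: "norm g \<le> R * (1 + norm x)" .
    have "norm ((\<alpha> / t) *\<^sub>R snd x) \<le> \<alpha> / t0 * (1 + norm x)"
      using norm_snd_le[of "snd x" "fst x"] t assms by (auto intro!: mult_mono divide_left_mono simp del: times_divide_eq_left)
    moreover have "snd y = - ((\<alpha> / t) *\<^sub>R snd x) - g" by (simp add: g_def)
    then have "norm (snd y) \<le> norm ((\<alpha> / t) *\<^sub>R snd x) + norm g"
      by (metis norm_minus_cancel norm_triangle_ineq4)
    moreover have "norm y \<le> norm (fst y) + norm (snd y)"
      using norm_Pair_le[of "fst y" "snd y"] by simp
    moreover have "norm (fst y) \<le> 1 + norm x"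
      using norm_snd_le[of "snd x" "fst x"] by (simp add: y1)
    ultimately show "norm y \<le> (1 + \<alpha> / t0 + R) * (1 + norm x)"
      using g by (simp add: algebra_simps)
  qed
qed

theorem theorem3p5:
  fixes f :: "nat \<Rightarrow> 'a::euclidean_space \<Rightarrow> real"
    and df :: "nat \<Rightarrow> 'a \<Rightarrow> 'a"
    and m :: nat and \<alpha> t0 :: real and u0 v0 :: 'a
  assumes m: "m \<ge> 1"
    and convex: "\<And>i. i \<in> {1..m} \<Longrightarrow> convex_on UNIV (f i)"
    and grad: "\<And>i u. i \<in> {1..m} \<Longrightarrow> (f i has_derivative (\<lambda>h. inner (df i u) h)) (at u)"
    and grad_cont: "\<And>i. i \<in> {1..m} \<Longrightarrow> continuous_on UNIV (df i)"
    and grad_lip: "\<And>i. i \<in> {1..m} \<Longrightarrow> \<exists>L. L-lipschitz_on UNIV (df i)"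
    and \<alpha>: "\<alpha> > 0" and t0: "t0 > 0"
  shows "\<exists>u v :: real \<Rightarrow> 'a.
           (\<forall>T>t0. abs_continuous_on {t0..T} u \<and> abs_continuous_on {t0..T} v) \<and>
           u t0 = u0 \<and> v t0 = v0 \<and>
           (AE t in lborel. t > t0 \<longrightarrow>
              (\<exists>u' v'. (u has_vector_derivative u') (at t) \<and>
                       (v has_vector_derivative v') (at t) \<and>
                       (u', v') \<in> Gmap \<alpha> m df t (u t) (v t)))"
proof -
  obtain K where K: "K \<ge> 0"
    "\<And>t x y. t0 \<le> t \<Longrightarrow> y \<in> Gmap \<alpha> m df t (fst x) (snd x) \<Longrightarrow> norm y \<le> K * (1 + norm x)"
    using Gmap_linear_growth[of m df \<alpha> t0] grad_lip \<alpha> t0 by blast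
  \<comment> \<open>The system becomes a single inclusion for the pair of position and velocity in
    the product space; its two components are read off at the end through the projections, which are
    linear and do not increase distances.\<close>
  interpret differential_inclusion "\<lambda>t x. Gmap \<alpha> m df t (fst x) (snd x)" t0 K
  proof
    show "closed {(t, x, y). t0 \<le> t \<and> y \<in> Gmap \<alpha> m df t (fst x) (snd x)}"
      using grad_cont t0 by (rule closed_graph_Gmap)
  qed (simp_all add: K convex_Gmap Gmap_nonempty[OF m])
  obtain x :: "real \<Rightarrow> 'a \<times> 'a" where x: "x t0 = (u0, v0)" "\<And>T. \<exists>L. L-lipschitz_on {t0..T} x"
    "AE t in lborel. t > t0 \<longrightarrow> (\<exists>d\<in>Gmap \<alpha> m df t (fst (x t)) (snd (x t)). (x has_vector_derivative d) (at t))"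
    using solution_exists[of "(u0, v0)"] by blast
  have ac: "abs_continuous_on {t0..T} (\<lambda>t. fst (x t))" "abs_continuous_on {t0..T} (\<lambda>t. snd (x t))" for T
  proof -
    obtain L where L: "L-lipschitz_on {t0..T} x" using x(2) by blast
    then have "L-lipschitz_on {t0..T} (\<lambda>t. fst (x t))" "L-lipschitz_on {t0..T} (\<lambda>t. snd (x t))"
      unfolding lipschitz_on_def by (meson dist_fst_le dist_snd_le order_trans)+
    then show "abs_continuous_on {t0..T} (\<lambda>t. fst (x t))" "abs_continuous_on {t0..T} (\<lambda>t. snd (x t))"
      by (simp_all add: lipschitz_on_imp_abs_continuous_on)
  qed
  have "AE t in lborel. t > t0 \<longrightarrow>
      (\<exists>u' v'. ((\<lambda>t. fst (x t)) has_vector_derivative u') (at t) \<and>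
               ((\<lambda>t. snd (x t)) has_vector_derivative v') (at t) \<and>
               (u', v') \<in> Gmap \<alpha> m df t (fst (x t)) (snd (x t)))"
    using x(3)
  proof (rule AE_mp, intro AE_I2 impI)
    fix t assume "t > t0 \<longrightarrow> (\<exists>d\<in>Gmap \<alpha> m df t (fst (x t)) (snd (x t)). (x has_vector_derivative d) (at t))"
      and "t > t0"
    then obtain d where d: "d \<in> Gmap \<alpha> m df t (fst (x t)) (snd (x t))" "(x has_vector_derivative d) (at t)"
      by blast
    then have "((\<lambda>t. fst (x t)) has_vector_derivative fst d) (at t)"
      "((\<lambda>t. snd (x t)) has_vector_derivative snd d) (at t)"
      by (auto intro: bounded_linear.has_vector_derivative bounded_linear_fst bounded_linear_snd)
    with d(1) show "\<exists>u' v'. ((\<lambda>t. fst (x t)) has_vector_derivative u') (at t) \<and>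
               ((\<lambda>t. snd (x t)) has_vector_derivative v') (at t) \<and>
               (u', v') \<in> Gmap \<alpha> m df t (fst (x t)) (snd (x t))"
      by (metis prod.collapse)
  qed
  then show ?thesis
    using x(1) ac by (intro exI[of _ "\<lambda>t. fst (x t)"] exI[of _ "\<lambda>t. snd (x t)"]) simp
qed

end
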